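(* Let $G$ be a connected chordal graph and $S,T$ distinct vertices of $G$. If $u$ is a bad vertex, then no non-separating simple path from $S$ to $T$ visits $u$.
   Context: A chordal graph is a simple undirected graph in which every cycle with four or more vertices has a chord. A path is a sequence $p_0,\dots,p_{|p|-1}$ of vertices with consecutive vertices adjacent; it is simple if its vertices are distinct; $p_{i,j}$ is the subpath $p_i,\dots,p_j$, and $p$ contains $q$ if $q=p_{i,j}$ for some $i\le j$. A path is separating if removing all of its edges from $G$ disconnects $G$, and non-separating otherwise. A separator path is a simple separating path not containing any separating path other than itself. A separator path $r$ is traversable if there is a simple path from $S$ to $T$ that contains $r$. A vertex $v$ is bad if there exists a traversable separator path $r=r_0,r_1,r_2$ with exactly two edges such that $r_1=v$. *)

theory Defs
  imports
    "Graph_Theory.Digraph_Component"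
    "Graph_Theory.Vertex_Walk"
    "HOL-Library.Sublist"
begin

text \<open>
  A simple undirected graph is a loop-free digraph whose arc relation is symmetric
  (\<^locale>\<open>pair_bidirected_digraph\<close>): the undirected edge $uv$ is the pair of arcs
  $(u,v)$, $(v,u)$. Finiteness is not imposed.
\<close>

text \<open>
  A cycle is given by its list of arcs, so its length is also its number of vertices. The library's
  notion of cycle admits $u, v, u$ in a symmetric digraph, but from length 3 on it coincides
  with undirected cycles.
\<close>
definition cycle_has_chord :: "'a pair_pre_digraph \<Rightarrow> ('a \<times> 'a) list \<Rightarrow> bool" where
  "cycle_has_chord G c \<longleftrightarrow>
     (\<exists>x \<in> fst ` set c. \<exists>y \<in> fst ` set c.
        (x, y) \<in> parcs G \<and> (x, y) \<notin> set c \<and> (y, x) \<notin> set c)"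

definition chordal_graph :: "'a pair_pre_digraph \<Rightarrow> bool" where
  "chordal_graph G \<longleftrightarrow> pair_bidirected_digraph G \<and>
     (\<forall>c. pre_digraph.cycle (with_proj G) c \<and> 4 \<le> length c \<longrightarrow> cycle_has_chord G c)"

text \<open>
  Paths are nonempty vertex lists satisfying \<^const>\<open>vwalk\<close>, simple paths those satisfying
  \<^const>\<open>vpath\<close>. Containment of paths is \<^const>\<open>sublist\<close> (contiguous and
  orientation-preserving).
\<close>

definition remove_path_edges :: "'a pair_pre_digraph \<Rightarrow> 'a list \<Rightarrow> 'a pair_pre_digraph" where
  "remove_path_edges G p =
     G\<lparr>parcs := parcs G - (set (vwalk_arcs p) \<union> (set (vwalk_arcs p))\<inverse>)\<rparr>"

definition separating_path :: "'a pair_pre_digraph \<Rightarrow> 'a list \<Rightarrow> bool" where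
  "separating_path G p \<longleftrightarrow>
     vwalk p (with_proj G) \<and>
     \<not> Digraph_Component.connected (with_proj (remove_path_edges G p))"

definition non_separating_path :: "'a pair_pre_digraph \<Rightarrow> 'a list \<Rightarrow> bool" where
  "non_separating_path G p \<longleftrightarrow> vwalk p (with_proj G) \<and> \<not> separating_path G p"

definition separator_path :: "'a pair_pre_digraph \<Rightarrow> 'a list \<Rightarrow> bool" where
  "separator_path G r \<longleftrightarrow>
     vpath r (with_proj G) \<and> separating_path G r \<and>
     (\<forall>q. separating_path G q \<and> sublist q r \<longrightarrow> q = r)"

definition simple_path_from_to :: "'a pair_pre_digraph \<Rightarrow> 'a \<Rightarrow> 'a \<Rightarrow> 'a list \<Rightarrow> bool" where
  "simple_path_from_to G s t p \<longleftrightarrow> vpath p (with_proj G) \<and> hd p = s \<and> last p = t"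

definition traversable :: "'a pair_pre_digraph \<Rightarrow> 'a \<Rightarrow> 'a \<Rightarrow> 'a list \<Rightarrow> bool" where
  "traversable G s t r \<longleftrightarrow> (\<exists>p. simple_path_from_to G s t p \<and> sublist r p)"

definition bad_vertex :: "'a pair_pre_digraph \<Rightarrow> 'a \<Rightarrow> 'a \<Rightarrow> 'a \<Rightarrow> bool" where
  "bad_vertex G s t v \<longleftrightarrow>
     (\<exists>r\<^sub>0 r\<^sub>2. separator_path G [r\<^sub>0, v, r\<^sub>2] \<and> traversable G s t [r\<^sub>0, v, r\<^sub>2])"

end

theory Submission
  imports Defs
begin

text \<open>
  Since \<open>r\<^sub>0 u r\<^sub>2\<close> separates \<open>G\<close> but neither of its edges does, these two edges form a cut, with
  \<open>u\<close> on one side \<open>A\<close> and \<open>r\<^sub>0\<close>, \<open>r\<^sub>2\<close> on the other. A simple path containing \<open>r\<^sub>0 u r\<^sub>2\<close> therefore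
  starts and ends outside \<open>A\<close>. Hence any simple path from \<open>S\<close> to \<open>T\<close> that visits \<open>u\<close> both enters
  and leaves \<open>A\<close>, which uses up both cut edges, so that its removal disconnects \<open>G\<close>.
\<close>

text \<open>If \<open>G\<close> is disconnected, take for \<open>A\<close> the vertices reachable
  from \<open>v\<close> along arcs in either direction: were that all of \<open>verts G\<close>, any
  two vertices would be joined through \<open>v\<close>. Conversely, such reachability never leaves
  \<open>A\<close>. Anchoring \<open>A\<close> at \<open>v\<close> later puts the bad vertex on a
  known side.\<close>

lemma (in wf_digraph) disconnected_iff_cut:
  assumes v: "v \<in> verts G"
  shows "\<not> Digraph_Component.connected G \<longleftrightarrow>
    (\<exists>A. v \<in> A \<and> \<not> verts G \<subseteq> A \<and> (\<forall>x y. (x, y) \<in> arcs_ends G \<longrightarrow> (x \<in> A \<longleftrightarrow> y \<in> A)))"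
    (is "_ \<longleftrightarrow> ?cut")
proof
  let ?R = "rtrancl_on (verts G) ((arcs_ends G)\<^sup>s)"
  have sym: "sym ?R"
    by (rule rtrancl_on_sym) (auto simp: sym_def symcl_def)
  assume "\<not> Digraph_Component.connected G"
  then obtain a b where ab: "a \<in> verts G" "b \<in> verts G" "(a, b) \<notin> ?R"
    using v unfolding connected_conv by auto
  define A where "A = {x. (v, x) \<in> ?R}"
  have "\<not> verts G \<subseteq> A"
  proof
    assume "verts G \<subseteq> A"
    then have "(a, v) \<in> ?R" "(v, b) \<in> ?R"
      using ab sym by (auto simp: A_def dest: symD)
    then show False
      using ab rtrancl_on_trans by metis
  qed
  moreover have "x \<in> A \<longleftrightarrow> y \<in> A" if "(x, y) \<in> arcs_ends G" for x y
  proof -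
    have "(x, y) \<in> (arcs_ends G)\<^sup>s" "(y, x) \<in> (arcs_ends G)\<^sup>s" "x \<in> verts G" "y \<in> verts G"
      using that by (force simp: symcl_def dest: adj_in_verts)+
    then show ?thesis
      unfolding A_def by (auto intro: rtrancl_on_into_rtrancl_on)
  qed
  moreover have "v \<in> A"
    using v by (simp add: A_def)
  ultimately show ?cut
    by blast
next
  assume ?cut
  then obtain A b where A: "v \<in> A" "b \<in> verts G" "b \<notin> A"
    and closed: "\<And>x y. (x, y) \<in> arcs_ends G \<Longrightarrow> x \<in> A \<longleftrightarrow> y \<in> A"
    by blast
  have "x \<in> A" if "(v, x) \<in> rtrancl_on (verts G) ((arcs_ends G)\<^sup>s)" for x
    using that by (induction rule: rtrancl_on_induct) (use A closed in \<open>auto simp: symcl_def\<close>)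
  then show "\<not> Digraph_Component.connected G"
    using v A unfolding connected_conv by blast
qed

text \<open>The arcs left after the removal are those that \<open>p\<close> uses in neither
  direction. So no remaining arc crosses \<open>A\<close> exactly when every arc of \<open>G\<close>
  crossing \<open>A\<close> lies on \<open>p\<close> in some orientation.\<close>

lemma (in pair_wf_digraph) separating_path_iff_cut:
  assumes "v \<in> pverts G" and "vwalk p (with_proj G)"
  shows "separating_path G p \<longleftrightarrow>
    (\<exists>A. v \<in> A \<and> \<not> pverts G \<subseteq> A \<and>
      (\<forall>x y. (x, y) \<in> parcs G \<and> (x \<in> A \<longleftrightarrow> y \<notin> A) \<longrightarrow>
        (x, y) \<in> set (vwalk_arcs p) \<or> (y, x) \<in> set (vwalk_arcs p)))"
proof -
  interpret R: pair_wf_digraph "remove_path_edges G p"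
    by unfold_locales (auto simp: remove_path_edges_def wellformed')
  have "v \<in> pverts (remove_path_edges G p)"
    using assms by (simp add: remove_path_edges_def)
  from R.disconnected_iff_cut[OF this] show ?thesis
    using assms(2) unfolding separating_path_def by (simp add: remove_path_edges_def) blast
qed

lemma mem_iff_hd_mem_if_arcs_closed:
  assumes "\<And>x y. (x, y) \<in> set (vwalk_arcs p) \<Longrightarrow> x \<in> A \<longleftrightarrow> y \<in> A" and "z \<in> set p"
  shows "z \<in> A \<longleftrightarrow> hd p \<in> A"
  using assms
proof (induction p rule: vwalk_arcs.induct)
  case (3 x y xs)
  have "x \<in> A \<longleftrightarrow> y \<in> A"
    using "3.prems"(1)[of x y] by simp
  moreover have "z \<in> A \<longleftrightarrow> y \<in> A" if "z \<in> set (y # xs)"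
    using "3.IH" "3.prems"(1) that by simp
  ultimately show ?case
    using "3.prems"(2) by auto
qed auto

theorem theorem5:
  fixes G :: "'a pair_pre_digraph" and S T u :: 'a
  assumes "chordal_graph G"
    and "Digraph_Component.connected (with_proj G)"
    and "S \<in> pverts G" and "T \<in> pverts G" and "S \<noteq> T"
    and "bad_vertex G S T u"
  shows "\<not> (\<exists>p. simple_path_from_to G S T p \<and> non_separating_path G p \<and> u \<in> set p)"
proof
  interpret pair_bidirected_digraph G
    using assms(1) by (simp add: chordal_graph_def)
  assume "\<exists>p. simple_path_from_to G S T p \<and> non_separating_path G p \<and> u \<in> set p"
  then obtain p where p: "vwalk p (with_proj G)" "distinct p" "hd p = S" "last p = T"
    and nonsep: "\<not> separating_path G p" and u_p: "u \<in> set p"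
    by (auto simp: simple_path_from_to_def non_separating_path_def)
  obtain r\<^sub>0 r\<^sub>2 where r: "separator_path G [r\<^sub>0, u, r\<^sub>2]" and "traversable G S T [r\<^sub>0, u, r\<^sub>2]"
    using assms(6) by (auto simp: bad_vertex_def)
  then obtain xs' ys' where q: "vwalk (xs' @ [r\<^sub>0, u, r\<^sub>2] @ ys') (with_proj G)"
      "distinct (xs' @ [r\<^sub>0, u, r\<^sub>2] @ ys')"
      "hd (xs' @ [r\<^sub>0, u, r\<^sub>2] @ ys') = S" "last (xs' @ [r\<^sub>0, u, r\<^sub>2] @ ys') = T"
    by (auto simp: traversable_def simple_path_from_to_def sublist_def)
  have r_walk: "vwalk [r\<^sub>0, u, r\<^sub>2] (with_proj G)" and r_sep: "separating_path G [r\<^sub>0, u, r\<^sub>2]"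
    and r_min: "\<And>q. separating_path G q \<Longrightarrow> sublist q [r\<^sub>0, u, r\<^sub>2] \<Longrightarrow> q = [r\<^sub>0, u, r\<^sub>2]"
    using r by (auto simp: separator_path_def)
  have u: "u \<in> pverts G"
    using r_walk by (auto simp: vwalk_def)
  from r_sep obtain A where A: "u \<in> A" "\<not> pverts G \<subseteq> A"
    and cross: "\<And>x y. (x, y) \<in> parcs G \<Longrightarrow> x \<in> A \<longleftrightarrow> y \<notin> A \<Longrightarrow>
      (x, y) = (r\<^sub>0, u) \<or> (x, y) = (u, r\<^sub>2) \<or> (y, x) = (r\<^sub>0, u) \<or> (y, x) = (u, r\<^sub>2)"
    unfolding separating_path_iff_cut[OF u r_walk] by auto
  \<comment> \<open>The same \<open>A\<close> now serves as witness for other walks: any walk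
    covering all edges across this cut is separating.\<close>
  have sepI: "separating_path G w" if "vwalk w (with_proj G)"
    and "\<And>x y. (x, y) \<in> parcs G \<Longrightarrow> x \<in> A \<longleftrightarrow> y \<notin> A \<Longrightarrow>
      (x, y) \<in> set (vwalk_arcs w) \<or> (y, x) \<in> set (vwalk_arcs w)" for w
    unfolding separating_path_iff_cut[OF u that(1)] using A that(2) by blast
  \<comment> \<open>Otherwise the edge between \<open>r\<^sub>0\<close> and \<open>u\<close> stays
    inside \<open>A\<close>, only the other edge can cross, and \<open>[u, r\<^sub>2]\<close> alone
    separates, against minimality.\<close>
  have "r\<^sub>0 \<notin> A"
  proof
    assume "r\<^sub>0 \<in> A"
    have "separating_path G [u, r\<^sub>2]"
    proof (rule sepI)
      show "vwalk [u, r\<^sub>2] (with_proj G)"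
        using r_walk by (auto simp: vwalk_def)
      show "(x, y) \<in> set (vwalk_arcs [u, r\<^sub>2]) \<or> (y, x) \<in> set (vwalk_arcs [u, r\<^sub>2])"
        if "(x, y) \<in> parcs G" "x \<in> A \<longleftrightarrow> y \<notin> A" for x y
        using cross[OF that] that(2) A(1) \<open>r\<^sub>0 \<in> A\<close> by auto
    qed
    then show False
      using r_min[of "[u, r\<^sub>2]"] by (simp add: sublist_Cons_right)
  qed
  have "r\<^sub>2 \<notin> A"
  proof
    assume "r\<^sub>2 \<in> A"
    have "separating_path G [r\<^sub>0, u]"
    proof (rule sepI)
      show "vwalk [r\<^sub>0, u] (with_proj G)"
        using r_walk by (auto simp: vwalk_def)
      show "(x, y) \<in> set (vwalk_arcs [r\<^sub>0, u]) \<or> (y, x) \<in> set (vwalk_arcs [r\<^sub>0, u])"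
        if "(x, y) \<in> parcs G" "x \<in> A \<longleftrightarrow> y \<notin> A" for x y
        using cross[OF that] that(2) A(1) \<open>r\<^sub>2 \<in> A\<close> by auto
    qed
    then show False
      using r_min[of "[r\<^sub>0, u]"] by (simp add: sublist_Cons_right)
  qed
  \<comment> \<open>Every edge across the cut has \<open>u\<close> as an endpoint, so a walk
    avoiding \<open>u\<close> cannot change sides.\<close>
  have side: "x \<in> A \<longleftrightarrow> y \<in> A"
    if "vwalk w (with_proj G)" "u \<notin> set w" "x \<in> set w" "y \<in> set w" for w x y
  proof -
    have "a \<in> A \<longleftrightarrow> b \<in> A" if ab: "(a, b) \<in> set (vwalk_arcs w)" for a b
    proof (rule ccontr)
      assume "\<not> (a \<in> A \<longleftrightarrow> b \<in> A)"
      moreover have "(a, b) \<in> parcs G"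
        using ab \<open>vwalk w (with_proj G)\<close> by (auto simp: vwalk_def)
      ultimately have "u = a \<or> u = b"
        using cross[of a b] by blast
      then show False
        using arcs_in_vwalk_arcs[OF ab] \<open>u \<notin> set w\<close> by auto
    qed
    then show ?thesis
      using mem_iff_hd_mem_if_arcs_closed that(3,4) by metis
  qed
  \<comment> \<open>The traversing path visits \<open>u\<close> only once, so its part from
    \<open>S\<close> to \<open>r\<^sub>0\<close> avoids \<open>u\<close>; likewise below for the
    part from \<open>r\<^sub>2\<close> to \<open>T\<close>.\<close>
  have "S \<notin> A"
  proof -
    have "vwalk (xs' @ [r\<^sub>0]) (with_proj G)"
      using vwalkI_append_l[of "xs' @ [r\<^sub>0]" "[u, r\<^sub>2] @ ys'"] q(1) by simp
    moreover have "S \<in> set (xs' @ [r\<^sub>0])"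
      using q(3) by (cases xs') auto
    ultimately show ?thesis
      using side[of "xs' @ [r\<^sub>0]" S r\<^sub>0] q(2) \<open>r\<^sub>0 \<notin> A\<close> by auto
  qed
  have "T \<notin> A"
  proof -
    have "vwalk (r\<^sub>2 # ys') (with_proj G)"
      using vwalkI_append_r[of "r\<^sub>2 # ys'" "xs' @ [r\<^sub>0, u]"] q(1) by simp
    moreover have "T \<in> set (r\<^sub>2 # ys')"
      using q(4) by (cases ys' rule: rev_cases) auto
    ultimately show ?thesis
      using side[of "r\<^sub>2 # ys'" T r\<^sub>2] q(2) \<open>r\<^sub>2 \<notin> A\<close> by auto
  qed
  obtain xs ys where xy: "p = xs @ u # ys" "u \<notin> set xs" "u \<notin> set ys"
    using u_p p(2) by (auto simp: in_set_conv_decomp)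
  \<comment> \<open>Since \<open>u\<close> lies in \<open>A\<close> but \<open>S\<close> and
    \<open>T\<close> do not, \<open>u\<close> is an inner vertex of \<open>p\<close>.\<close>
  have ne: "xs \<noteq> []" "ys \<noteq> []"
    using xy p(3,4) A(1) \<open>S \<notin> A\<close> \<open>T \<notin> A\<close> by auto
  have walks: "vwalk xs (with_proj G)" "vwalk ys (with_proj G)"
    using vwalkI_append_l[of xs "u # ys"] vwalkI_append_r[of ys "xs @ [u]"] p(1) xy(1) ne by simp_all
  have "last xs \<notin> A"
    using side[OF walks(1) xy(2), of "last xs" S] ne p(3) xy(1) \<open>S \<notin> A\<close> by auto
  have "hd ys \<notin> A"
    using side[OF walks(2) xy(3), of "hd ys" T] ne p(4) xy(1) \<open>T \<notin> A\<close> by auto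
  have arcs: "(last xs, u) \<in> set (vwalk_arcs p)" "(u, hd ys) \<in> set (vwalk_arcs p)"
    using ne by (auto simp: xy(1) vwalk_arcs_append)
  then have "(last xs, u) \<in> parcs G" "(u, hd ys) \<in> parcs G"
    using p(1) by (auto simp: vwalk_def)
  \<comment> \<open>Both neighbours of \<open>u\<close> on \<open>p\<close> lie outside
    \<open>A\<close>, so the two arcs at \<open>u\<close> cross the cut. As \<open>p\<close> is
    simple, they come from different cut edges.\<close>
  then have "last xs \<in> {r\<^sub>0, r\<^sub>2}" "hd ys \<in> {r\<^sub>0, r\<^sub>2}"
    using cross[of "last xs" u] cross[of u "hd ys"] A(1) \<open>last xs \<notin> A\<close> \<open>hd ys \<notin> A\<close> by auto
  moreover have "last xs \<noteq> hd ys"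
    using p(2) xy(1) last_in_set[OF ne(1)] hd_in_set[OF ne(2)] by auto
  \<comment> \<open>The path \<open>p\<close> may run through \<open>r\<^sub>0\<close> and
    \<open>r\<^sub>2\<close> in either order, so orientations are left open.\<close>
  ultimately have cut_used: "(r\<^sub>0, u) \<in> set (vwalk_arcs p) \<or> (u, r\<^sub>0) \<in> set (vwalk_arcs p)"
      "(r\<^sub>2, u) \<in> set (vwalk_arcs p) \<or> (u, r\<^sub>2) \<in> set (vwalk_arcs p)"
    using arcs by auto
  have "separating_path G p"
    using p(1)
  proof (rule sepI)
    show "(x, y) \<in> set (vwalk_arcs p) \<or> (y, x) \<in> set (vwalk_arcs p)"
      if "(x, y) \<in> parcs G" "x \<in> A \<longleftrightarrow> y \<notin> A" for x y
      using cross[OF that] cut_used by auto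
  qed
  with nonsep show False
    by contradiction
qed

end
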